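(* Let $S\subset\mathbb{R}^m$ be a nonempty finite set with $S\cap -S=\varnothing$, and define $f\colon S\cup -S\to\{-1,1\}$ by $f(x)=+1$ for $x\in S$ and $f(x)=-1$ for $x\in -S$. Let $d$ be an integer and $\psi\colon S\cup-S\to\mathbb{R}$ a function such that, for some $\delta\in(0,1)$, $\psi(x)>\delta|\psi(-x)|$ for all $x\in S$, and $\sum_{x\in S\cup -S}\psi(x)u(x)=0$ for every real polynomial $u$ of degree at most $d$. Then \[R^+(f,d)\geq\frac{2\delta}{1+\delta}.\]
   Context: $-S=\{-x:x\in S\}$. $R^+(f,d)=\inf_{p,q}\max_{x}|f(x)-p(x)/q(x)|$, the infimum over real polynomials $p,q$ of total degree at most $d$ with $q$ positive on $S\cup -S$. *)

theory Defs
  imports "HOL-Analysis.Analysis" "HOL-Library.Poly_Mapping" "HOL-Library.Extended_Real"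
begin

text \<open>Real polynomials in the variables indexed by \<open>'m\<close>: a monomial is its exponent vector
  \<open>'m \<Rightarrow>\<^sub>0 nat\<close>, and a polynomial maps monomials to coefficients, almost all of them zero.\<close>

type_synonym 'm real_mpoly = "('m \<Rightarrow>\<^sub>0 nat) \<Rightarrow>\<^sub>0 real"

definition mpoly_eval :: "('m::finite) real_mpoly \<Rightarrow> real ^ 'm \<Rightarrow> real" where
  "mpoly_eval p x = (\<Sum>a\<in>Poly_Mapping.keys p.
     Poly_Mapping.lookup p a * (\<Prod>i\<in>UNIV. (x $ i) ^ Poly_Mapping.lookup a i))"

text \<open>The bound is an integer and the zero polynomial has degree \<open>-\<infinity>\<close>: for \<open>d < 0\<close>
  only the zero polynomial qualifies.\<close>

definition total_degree_le :: "('m::finite) real_mpoly \<Rightarrow> int \<Rightarrow> bool" where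
  "total_degree_le p d \<longleftrightarrow>
     (\<forall>a\<in>Poly_Mapping.keys p. int (\<Sum>i\<in>UNIV. Poly_Mapping.lookup a i) \<le> d)"

text \<open>\<open>R_plus X f d\<close> is \<open>R\<^sup>+(f, d)\<close> for \<open>f\<close> with finite nonempty domain \<open>X\<close>.  It takes values in
  the extended reals so that the infimum over the empty family (no admissible \<open>q\<close> exists
  when \<open>d < 0\<close>) is \<open>\<infinity>\<close>.\<close>

definition R_plus :: "(real ^ 'm::finite) set \<Rightarrow> (real ^ 'm \<Rightarrow> real) \<Rightarrow> int \<Rightarrow> ereal" where
  "R_plus X f d =
     Inf {ereal (Max ((\<lambda>x. \<bar>f x - mpoly_eval p x / mpoly_eval q x\<bar>) ` X)) | p q.
       total_degree_le p d \<and> total_degree_le q d \<and> (\<forall>x\<in>X. mpoly_eval q x > 0)}"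

end

theory Submission imports Defs begin

text \<open>If \<open>p / q\<close> approximates \<open>f\<close> within \<open>\<epsilon> < 2 \<delta> / (1 + \<delta>)\<close>, then
  \<open>u(x) = q(x) + q(- x) + p(x) - p(- x)\<close> has degree at most \<open>d\<close> and satisfies
  \<open>u(x) > 0\<close> and \<open>\<bar>u(- x)\<bar> \<le> \<delta> u(x)\<close> on \<open>S\<close>: for \<open>Q = q(x) + q(- x)\<close> the difference
  \<open>p(x) - p(- x)\<close> lies between \<open>(1 - \<epsilon>) Q\<close> and \<open>(1 + \<epsilon>) Q\<close>, and \<open>\<epsilon> / (2 - \<epsilon>) \<le> \<delta>\<close>.
  Hence \<open>\<psi>(x) u(x) + \<psi>(- x) u(- x) > 0\<close> for all \<open>x\<close> in \<open>S\<close>, and \<open>\<psi>\<close> is not orthogonal to \<open>u\<close>.\<close>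

text \<open>Substituting - x multiplies a monomial of degree k by (-1)^k. Only signs of coefficients
  change, so the support, and with it the degree bound, is preserved.\<close>

lemma ex_reflected_mpoly:
  fixes p :: "('m::finite) real_mpoly"
  assumes "total_degree_le p d"
  obtains p' where "total_degree_le p' d" "\<And>x. mpoly_eval p' x = mpoly_eval p (- x)"
proof -
  define p' where
    "p' = Poly_Mapping.mapp (\<lambda>a c. (-1) ^ (\<Sum>i\<in>UNIV. Poly_Mapping.lookup a i) * c) p"
  have lookup: "Poly_Mapping.lookup p' a =
      (-1) ^ (\<Sum>i\<in>UNIV. Poly_Mapping.lookup a i) * Poly_Mapping.lookup p a" for a
    by (auto simp: p'_def lookup_mapp when_def in_keys_iff)
  have keys: "Poly_Mapping.keys p' = Poly_Mapping.keys p"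
    by (auto simp: in_keys_iff lookup)
  have monom: "(\<Prod>i\<in>UNIV. ((- x) $ i) ^ Poly_Mapping.lookup a i) =
      (-1) ^ (\<Sum>i\<in>UNIV. Poly_Mapping.lookup a i) * (\<Prod>i\<in>UNIV. (x $ i) ^ Poly_Mapping.lookup a i)"
    for x :: "real ^ 'm" and a
  proof -
    have "(\<Prod>i\<in>UNIV. ((- x) $ i) ^ Poly_Mapping.lookup a i) =
        (\<Prod>i\<in>UNIV. (-1) ^ Poly_Mapping.lookup a i * (x $ i) ^ Poly_Mapping.lookup a i)"
      by (intro prod.cong refl) (simp flip: power_mult_distrib)
    then show ?thesis
      by (simp add: prod.distrib power_sum)
  qed
  show thesis
  proof
    show "total_degree_le p' d"
      using assms by (simp add: total_degree_le_def keys)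
    show "mpoly_eval p' x = mpoly_eval p (- x)" for x
      unfolding mpoly_eval_def keys monom lookup by (simp add: mult_ac)
  qed
qed

lemma sum_Un_uminus:
  fixes g :: "'a::ab_group_add \<Rightarrow> 'b::comm_monoid_add"
  assumes "finite S" and "S \<inter> uminus ` S = {}"
  shows "(\<Sum>x\<in>S \<union> uminus ` S. g x) = (\<Sum>x\<in>S. g x + g (- x))"
  using assms by (simp add: sum.union_disjoint sum.reindex sum.distrib o_def)

text \<open>Applied with A = q(x), B = q(- x), a = p(x), b = p(- x). In terms of Q = A + B and r = a
  - b, the second claim splits into (1 - \<delta>) Q \<le> (1 + \<delta>) r and (1 - \<delta>) r
  \<le> (1 + \<delta>) Q.\<close>

lemma antisymmetric_combination_bound:
  fixes a b A B \<epsilon> \<delta> :: real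
  assumes "0 < A" "0 < B" "0 < \<delta>" "\<delta> < 1" "\<epsilon> < 2 * \<delta> / (1 + \<delta>)"
    and a: "\<bar>1 - a / A\<bar> \<le> \<epsilon>" and b: "\<bar>-1 - b / B\<bar> \<le> \<epsilon>"
  shows "0 < A + B + a - b" and "\<bar>A + B - (a - b)\<bar> \<le> \<delta> * (A + B + a - b)"
proof -
  define Q r where "Q = A + B" and "r = a - b"
  have Q: "0 < Q" using assms by (simp add: Q_def)
  have \<epsilon>: "\<epsilon> * (1 + \<delta>) < 2 * \<delta>" using assms by (simp add: field_simps)
  have "(1 - \<epsilon>) * A \<le> a" "a \<le> (1 + \<epsilon>) * A" "b \<le> - ((1 - \<epsilon>) * B)" "- ((1 + \<epsilon>) * B) \<le> b"
    using a b assms(1,2) by (auto simp: abs_le_iff field_simps)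
  then have r: "(1 - \<epsilon>) * Q \<le> r" "r \<le> (1 + \<epsilon>) * Q"
    by (simp_all add: Q_def r_def algebra_simps)
  have "0 \<le> \<epsilon>" using a by linarith
  \<comment> \<open>Since \<delta> < 1 gives 2 \<delta> < 1 + \<delta>, the lower bound (1 -
    \<epsilon>) Q on r is positive.\<close>
  have "\<epsilon> < 1" using \<open>\<epsilon> < 2 * \<delta> / (1 + \<delta>)\<close> \<open>0 < \<delta>\<close> \<open>\<delta> < 1\<close>
    by (smt (verit) less_divide_eq_1_pos)
  then have "0 < r" using r(1) Q by (smt (verit) mult_pos_pos)
  with Q show "0 < A + B + a - b" by (simp add: Q_def r_def)
  have "(1 - \<delta>) * Q \<le> (1 + \<delta>) * ((1 - \<epsilon>) * Q)"
  proof -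
    \<comment> \<open>Here the constant arises: this inequality is equivalent to \<epsilon> \<le> 2
      \<delta> / (1 + \<delta>).\<close>
    have "1 - \<delta> \<le> (1 + \<delta>) * (1 - \<epsilon>)" using \<epsilon> by (simp add: algebra_simps)
    then show ?thesis using Q by (metis mult.assoc mult_right_mono less_imp_le)
  qed
  also have "\<dots> \<le> (1 + \<delta>) * r" using r(1) \<open>0 < \<delta>\<close> by (intro mult_left_mono) auto
  finally have 1: "Q - r \<le> \<delta> * (Q + r)" by (simp add: algebra_simps)
  have "(1 - \<delta>) * r \<le> (1 - \<delta>) * ((1 + \<epsilon>) * Q)"
    using r(2) \<open>\<delta> < 1\<close> by (intro mult_left_mono) auto
  also have "\<dots> \<le> (1 + \<delta>) * Q"
  proof -
    \<comment> \<open>The upper bound on r asks for \<epsilon> (1 - \<delta>) \<le> 2 \<delta>, and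
      \<epsilon> (1 - \<delta>) \<le> \<epsilon> (1 + \<delta>).\<close>
    have "0 \<le> \<epsilon> * \<delta>" using \<open>0 \<le> \<epsilon>\<close> \<open>0 < \<delta>\<close> by simp
    then have "(1 - \<delta>) * (1 + \<epsilon>) \<le> 1 + \<delta>" using \<epsilon> by (simp add: algebra_simps)
    then show ?thesis using Q by (metis mult.assoc mult_right_mono less_imp_le)
  qed
  finally have 2: "r - Q \<le> \<delta> * (Q + r)" by (simp add: algebra_simps)
  have "\<bar>Q - r\<bar> \<le> \<delta> * (Q + r)" using 1 2 by linarith
  moreover have "A + B + a - b = Q + r" "A + B - (a - b) = Q - r" by (simp_all add: Q_def r_def)
  ultimately show "\<bar>A + B - (a - b)\<bar> \<le> \<delta> * (A + B + a - b)" by simp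
qed

theorem theorem4p7:
  fixes S :: "(real ^ 'm::finite) set"
    and f \<psi> :: "real ^ 'm \<Rightarrow> real"
    and d :: int and \<delta> :: real
  assumes "finite S" and "S \<noteq> {}" and "S \<inter> uminus ` S = {}"
    and "\<And>x. x \<in> S \<Longrightarrow> f x = 1"
    and "\<And>x. x \<in> uminus ` S \<Longrightarrow> f x = -1"
    and "0 < \<delta>" and "\<delta> < 1"
    and "\<And>x. x \<in> S \<Longrightarrow> \<psi> x > \<delta> * \<bar>\<psi> (- x)\<bar>"
    and "\<And>u :: 'm real_mpoly. total_degree_le u d \<Longrightarrow>
           (\<Sum>x\<in>S \<union> uminus ` S. \<psi> x * mpoly_eval u x) = 0"
  shows "R_plus (S \<union> uminus ` S) f d \<ge> ereal (2 * \<delta> / (1 + \<delta>))"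
proof -
  let ?X = "S \<union> uminus ` S"
  have "2 * \<delta> / (1 + \<delta>) \<le> Max ((\<lambda>x. \<bar>f x - mpoly_eval p x / mpoly_eval q x\<bar>) ` ?X)"
    if p: "total_degree_le p d" and q: "total_degree_le q d"
      and pos: "\<forall>x\<in>?X. mpoly_eval q x > 0" for p q :: "'m real_mpoly"
  proof (rule ccontr)
    define \<epsilon> where "\<epsilon> = Max ((\<lambda>x. \<bar>f x - mpoly_eval p x / mpoly_eval q x\<bar>) ` ?X)"
    assume "\<not> ?thesis"
    then have \<epsilon>: "\<epsilon> < 2 * \<delta> / (1 + \<delta>)" by (simp add: \<epsilon>_def)
    have err: "\<bar>f x - mpoly_eval p x / mpoly_eval q x\<bar> \<le> \<epsilon>" if "x \<in> ?X" for x
      unfolding \<epsilon>_def using that \<open>finite S\<close> by (intro Max_ge) auto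
    obtain p' where p': "total_degree_le p' d" "\<And>x. mpoly_eval p' x = mpoly_eval p (- x)"
      using ex_reflected_mpoly[OF p] by blast
    obtain q' where q': "total_degree_le q' d" "\<And>x. mpoly_eval q' x = mpoly_eval q (- x)"
      using ex_reflected_mpoly[OF q] by blast
    \<comment> \<open>A plain function suffices: orthogonality is applied to p, q and their
      reflections separately, and linearity of the sum does the rest.\<close>
    define u where
      "u x = mpoly_eval q x + mpoly_eval q (- x) + mpoly_eval p x - mpoly_eval p (- x)" for x
    have "(\<Sum>x\<in>?X. \<psi> x * u x) =
        (\<Sum>x\<in>?X. \<psi> x * mpoly_eval q x) + (\<Sum>x\<in>?X. \<psi> x * mpoly_eval q' x)
        + (\<Sum>x\<in>?X. \<psi> x * mpoly_eval p x) - (\<Sum>x\<in>?X. \<psi> x * mpoly_eval p' x)"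
      by (simp only: u_def p'(2) q'(2) distrib_left right_diff_distrib sum.distrib sum_subtractf)
    also have "\<dots> = 0"
      using assms(9)[OF p] assms(9)[OF q] assms(9)[OF p'(1)] assms(9)[OF q'(1)] by simp
    finally have "(\<Sum>x\<in>S. \<psi> x * u x + \<psi> (- x) * u (- x)) = 0"
      using sum_Un_uminus[OF assms(1,3), of "\<lambda>x. \<psi> x * u x"] by simp
    moreover have "(\<Sum>x\<in>S. \<psi> x * u x + \<psi> (- x) * u (- x)) > 0"
    proof (rule sum_pos[OF \<open>finite S\<close> \<open>S \<noteq> {}\<close>])
      fix x assume x: "x \<in> S"
      have q_pos: "mpoly_eval q x > 0" "mpoly_eval q (- x) > 0" using pos x by auto
      have err_x: "\<bar>1 - mpoly_eval p x / mpoly_eval q x\<bar> \<le> \<epsilon>"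
          "\<bar>-1 - mpoly_eval p (- x) / mpoly_eval q (- x)\<bar> \<le> \<epsilon>"
        using err[of x] err[of "- x"] assms(4)[OF x] assms(5)[of "- x"] x by simp_all
      \<comment> \<open>The q-part of \<open>u\<close> is even and the p-part odd, so only the
        latter changes sign.\<close>
      have reflect: "u (- x) = mpoly_eval q x + mpoly_eval q (- x)
          - (mpoly_eval p x - mpoly_eval p (- x))"
        by (simp add: u_def)
      have u: "0 < u x" "\<bar>u (- x)\<bar> \<le> \<delta> * u x"
        using antisymmetric_combination_bound[OF q_pos \<open>0 < \<delta>\<close> \<open>\<delta> < 1\<close> \<epsilon> err_x]
        unfolding reflect by (simp_all only: u_def)
      \<comment> \<open>The term at - x is strictly dominated: one factor \<delta> comes from
        \<open>u\<close>, and the hypothesis on \<psi> absorbs it.\<close>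
      have "\<bar>\<psi> (- x) * u (- x)\<bar> \<le> \<bar>\<psi> (- x)\<bar> * (\<delta> * u x)"
        unfolding abs_mult using u(2) by (intro mult_left_mono) auto
      also have "\<dots> = \<delta> * \<bar>\<psi> (- x)\<bar> * u x" by simp
      also have "\<dots> < \<psi> x * u x" using assms(8)[OF x] u(1) by (rule mult_strict_right_mono)
      finally show "0 < \<psi> x * u x + \<psi> (- x) * u (- x)" by linarith
    qed
    ultimately show False by simp
  qed
  \<comment> \<open>A lower bound for every member bounds the infimum, also when the family is empty
    and the infimum is \<infinity>.\<close>
  then show ?thesis
    unfolding R_plus_def by (intro Inf_greatest) auto
qed

end
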